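(* Let $(\{A_n\}_{n},\{\Psi_n\}_{n})$ and $(\{B_n\}_{n},\{\Phi_n\}_{n})$ be two Parseval operator-valued p-ASFs in $\mathcal{B}(\mathcal{X},\mathcal{Y})$ which are orthogonal. If $C,D,E,F\in\mathcal{B}(\mathcal{X})$ are such that $EC+FD=I_{\mathcal{X}}$, then $$(\{A_nC+B_nD\}_{n},\{E\Psi_n+F\Phi_n\}_{n})$$ is a Parseval operator-valued p-ASF in $\mathcal{B}(\mathcal{X},\mathcal{Y})$. In particular, if scalars $c,d,e,f$ satisfy $ce+df=1$, then $(\{cA_n+dB_n\}_{n},\{e\Psi_n+f\Phi_n\}_{n})$ is a Parseval operator-valued p-ASF.
   Context: Banach spaces are over $\mathbb{K}=\mathbb{R}$ or $\mathbb{C}$; $\mathcal{X},\mathcal{Y}$ are Banach spaces, $p\in[1,\infty)$, $\mathcal{B}(\mathcal{X},\mathcal{Y})$ is the space of bounded linear operators and $\mathcal{B}(\mathcal{X})=\mathcal{B}(\mathcal{X},\mathcal{X})$. $\ell^p(\mathbb{N})\otimes\mathcal{Y}$ is the completion of the algebraic tensor product in a fixed cross norm ($\|a\otimes y\|=\|a\|\|y\|$) for which, for all $T\in\mathcal{B}(\ell^p(\mathbb{N}))$ and $R\in\mathcal{B}(\mathcal{Y})$, $T\otimes R$ extends to a bounded operator with $\|T\otimes R\|\le\|T\|\|R\|$. With $\{e_n\}_n$ the standard Schauder basis of $\ell^p(\mathbb{N})$, $L_n:\mathcal{Y}\to\ell^p(\mathbb{N})\otimes\mathcal{Y}$ is $L_ny=e_n\otimes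 y$, and $\Gamma_n:\ell^p(\mathbb{N})\otimes\mathcal{Y}\to\mathcal{Y}$ is the bounded linear operator with $\Gamma_n(\{a_m\}_m\otimes y)=a_ny$. Thus $\Gamma_nL_n=I_{\mathcal{Y}}$, $\Gamma_nL_m=0$ for $n\ne m$, and $\sum_{n=1}^\infty L_n\Gamma_nz=z$ for all $z$. For collections $\{A_n\}_{n}$ in $\mathcal{B}(\mathcal{X},\mathcal{Y})$ and $\{\Psi_n\}_{n}$ in $\mathcal{B}(\mathcal{Y},\mathcal{X})$, the pair is an operator-valued p-approximate Schauder frame (operator-valued p-ASF) in $\mathcal{B}(\mathcal{X},\mathcal{Y})$ if: (i) the frame operator $S_{A,\Psi}x=\sum_{n=1}^\infty\Psi_nA_nx$ is a well-defined bounded linear invertible operator on $\mathcal{X}$; (ii) the analysis operator $\theta_A:\mathcal{X}\to\ell^p(\mathbb{N})\otimes\mathcal{Y}$, $\theta_Ax=\sum_{n=1}^\infty L_nA_nx$, is a well-defined bounded linear operator; (iii) the synthesis operator $\theta_\Psi:\ell^p(\mathbb{N})\otimes\mathcal{Y}\to\mathcal{X}$, $\theta_\Psi z=\sum_{n=1}^\infty\Psi_n\Gamma_nz$, is a well-defined bounded linear operator. It is Parseval if $S_{A,\Psi}=I_{\mathcal{X}}$. Two operator-valued p-ASFs $(\{A_n\}_{n},\{\Psi_n\}_{n})$ and $(\{B_n\}_{n},\{\Phi_n\}_{n})$ are orthogonal if $\theta_\Psi\theta_B=\theta_\Phi\theta_A=0$. *)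

theory Defs
  imports "HOL-Analysis.Analysis"
begin

section \<open>Banach spaces over \<open>\<real>\<close> or \<open>\<complex>\<close> and their bounded operators\<close>

text \<open>The scalar field is a type of class \<^class>\<open>real_normed_field\<close>, whose norm is multiplicative.
  By the Gelfand-Mazur theorem \<open>\<real>\<close> and \<open>\<complex>\<close> are, up to isometric isomorphism, the only such
  fields. The library's class \<^class>\<open>banach\<close> supplies the norm, the completeness and the underlying
  real structure; \<open>scale_of_real\<close> says that the latter is obtained by restriction of scalars.\<close>

locale banach_space_over = vector_space scale
  for scale :: "'k::real_normed_field \<Rightarrow> 'a::banach \<Rightarrow> 'a" +
  assumes norm_scale: "norm (scale c x) = norm c * norm x"
    and scale_of_real: "scale (of_real r) x = r *\<^sub>R x"

definition bounded_op ::
  "('k::real_normed_field \<Rightarrow> 'a::banach \<Rightarrow> 'a) \<Rightarrow> ('k \<Rightarrow> 'b::banach \<Rightarrow> 'b) \<Rightarrow> ('a \<Rightarrow> 'b) \<Rightarrow> bool" where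
  "bounded_op sa sb f \<longleftrightarrow> Vector_Spaces.linear sa sb f \<and> bounded_linear f"

definition invertible_op ::
  "('k::real_normed_field \<Rightarrow> 'a::banach \<Rightarrow> 'a) \<Rightarrow> ('a \<Rightarrow> 'a) \<Rightarrow> bool" where
  "invertible_op sa f \<longleftrightarrow> bounded_op sa sa f \<and>
     (\<exists>g. bounded_op sa sa g \<and> f \<circ> g = id \<and> g \<circ> f = id)"


section \<open>The sequence space \<open>\<ell>\<^sup>p\<close>\<close>

definition lp :: "real \<Rightarrow> (nat \<Rightarrow> 'k::real_normed_field) set" where
  "lp p = {a. summable (\<lambda>n. norm (a n) powr p)}"

definition lp_norm :: "real \<Rightarrow> (nat \<Rightarrow> 'k::real_normed_field) \<Rightarrow> real" where
  "lp_norm p a = (\<Sum>n. norm (a n) powr p) powr (1 / p)"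

definition lp_basis :: "nat \<Rightarrow> nat \<Rightarrow> 'k::real_normed_field" where
  "lp_basis n = (\<lambda>m. if m = n then 1 else 0)"

text \<open>Operators on \<open>\<ell>\<^sup>p\<close> are functions on all sequences; only their values on \<^const>\<open>lp\<close> matter.\<close>

definition lp_bounded_op ::
  "real \<Rightarrow> ((nat \<Rightarrow> 'k::real_normed_field) \<Rightarrow> (nat \<Rightarrow> 'k)) \<Rightarrow> bool" where
  "lp_bounded_op p T \<longleftrightarrow>
     (\<forall>a\<in>lp p. T a \<in> lp p) \<and>
     (\<forall>a\<in>lp p. \<forall>b\<in>lp p. T (\<lambda>n. a n + b n) = (\<lambda>n. T a n + T b n)) \<and>
     (\<forall>c. \<forall>a\<in>lp p. T (\<lambda>n. c * a n) = (\<lambda>n. c * T a n)) \<and>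
     (\<exists>M. \<forall>a\<in>lp p. lp_norm p (T a) \<le> M * lp_norm p a)"

definition lp_onorm ::
  "real \<Rightarrow> ((nat \<Rightarrow> 'k::real_normed_field) \<Rightarrow> (nat \<Rightarrow> 'k)) \<Rightarrow> real" where
  "lp_onorm p T = (SUP a\<in>lp p. lp_norm p (T a) / lp_norm p a)"


section \<open>The tensor product of \<open>\<ell>\<^sup>p\<close> with a Banach space\<close>

text \<open>The algebraic tensor product is realised as a space of functionals on the space of bilinear
  forms on \<open>\<ell>\<^sup>p \<times> Y\<close>: the elementary tensor \<open>a \<otimes> y\<close> is evaluation at \<open>(a, y)\<close>, and the tensor
  product is the set of finite sums of elementary tensors. Functionals are given the value 0 at
  functions that are not bilinear forms.\<close>

definition bilinear_form ::
  "real \<Rightarrow> ('k::real_normed_field \<Rightarrow> 'y::banach \<Rightarrow> 'y) \<Rightarrow> ((nat \<Rightarrow> 'k) \<Rightarrow> 'y \<Rightarrow> 'k) \<Rightarrow> bool" where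
  "bilinear_form p sY \<beta> \<longleftrightarrow>
     (\<forall>a\<in>lp p. \<forall>b\<in>lp p. \<forall>y. \<beta> (\<lambda>n. a n + b n) y = \<beta> a y + \<beta> b y) \<and>
     (\<forall>c. \<forall>a\<in>lp p. \<forall>y. \<beta> (\<lambda>n. c * a n) y = c * \<beta> a y) \<and>
     (\<forall>a\<in>lp p. \<forall>y z. \<beta> a (y + z) = \<beta> a y + \<beta> a z) \<and>
     (\<forall>a\<in>lp p. \<forall>c y. \<beta> a (sY c y) = c * \<beta> a y)"

definition elem_tensor ::
  "real \<Rightarrow> ('k::real_normed_field \<Rightarrow> 'y::banach \<Rightarrow> 'y) \<Rightarrow> (nat \<Rightarrow> 'k) \<Rightarrow> 'y \<Rightarrow>
   (((nat \<Rightarrow> 'k) \<Rightarrow> 'y \<Rightarrow> 'k) \<Rightarrow> 'k)" where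
  "elem_tensor p sY a y = (\<lambda>\<beta>. if bilinear_form p sY \<beta> then \<beta> a y else 0)"

definition alg_tensor ::
  "real \<Rightarrow> ('k::real_normed_field \<Rightarrow> 'y::banach \<Rightarrow> 'y) \<Rightarrow>
   (((nat \<Rightarrow> 'k) \<Rightarrow> 'y \<Rightarrow> 'k) \<Rightarrow> 'k) set" where
  "alg_tensor p sY =
     {(\<lambda>\<beta>. \<Sum>i<m. elem_tensor p sY (a i) (y i) \<beta>) | (m::nat) a y. \<forall>i<m. a i \<in> lp p}"

text \<open>A Banach space \<open>Z\<close> with an injective linear map \<open>j\<close> of dense range from the algebraic tensor
  product: \<open>Z\<close> is the completion of the algebraic tensor product in the norm \<open>u \<mapsto> norm (j u)\<close>,
  and every completion in a norm arises in this way. Thus fixing \<open>Z\<close> and \<open>j\<close> amounts to fixing the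
  norm.\<close>

locale lp_tensor =
  Y: banach_space_over sY + Z: banach_space_over sZ
  for p :: real
    and sY :: "'k::real_normed_field \<Rightarrow> 'y::banach \<Rightarrow> 'y"
    and sZ :: "'k \<Rightarrow> 'z::banach \<Rightarrow> 'z"
    and j :: "(((nat \<Rightarrow> 'k) \<Rightarrow> 'y \<Rightarrow> 'k) \<Rightarrow> 'k) \<Rightarrow> 'z" +
  assumes p_ge_1: "1 \<le> p"
    and j_add: "u \<in> alg_tensor p sY \<Longrightarrow> v \<in> alg_tensor p sY \<Longrightarrow> j (\<lambda>\<beta>. u \<beta> + v \<beta>) = j u + j v"
    and j_scale: "u \<in> alg_tensor p sY \<Longrightarrow> j (\<lambda>\<beta>. c * u \<beta>) = sZ c (j u)"
    and j_inj: "inj_on j (alg_tensor p sY)"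
    and j_dense: "closure (j ` alg_tensor p sY) = UNIV"
    and cross_norm: "a \<in> lp p \<Longrightarrow> norm (j (elem_tensor p sY a y)) = lp_norm p a * norm y"
    and tensor_op: "lp_bounded_op p T \<Longrightarrow> bounded_op sY sY R \<Longrightarrow>
      \<exists>V. bounded_op sZ sZ V \<and>
          (\<forall>a\<in>lp p. \<forall>y. V (j (elem_tensor p sY a y)) = j (elem_tensor p sY (T a) (R y))) \<and>
          onorm V \<le> lp_onorm p T * onorm R"

definition tensor_L ::
  "real \<Rightarrow> ('k::real_normed_field \<Rightarrow> 'y::banach \<Rightarrow> 'y) \<Rightarrow>
   ((((nat \<Rightarrow> 'k) \<Rightarrow> 'y \<Rightarrow> 'k) \<Rightarrow> 'k) \<Rightarrow> 'z::banach) \<Rightarrow> nat \<Rightarrow> 'y \<Rightarrow> 'z" where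
  "tensor_L p sY j n y = j (elem_tensor p sY (lp_basis n) y)"

definition tensor_Gamma ::
  "real \<Rightarrow> ('k::real_normed_field \<Rightarrow> 'y::banach \<Rightarrow> 'y) \<Rightarrow> ('k \<Rightarrow> 'z::banach \<Rightarrow> 'z) \<Rightarrow>
   ((((nat \<Rightarrow> 'k) \<Rightarrow> 'y \<Rightarrow> 'k) \<Rightarrow> 'k) \<Rightarrow> 'z) \<Rightarrow> nat \<Rightarrow> 'z \<Rightarrow> 'y" where
  "tensor_Gamma p sY sZ j n =
     (THE g. bounded_op sZ sY g \<and> (\<forall>a\<in>lp p. \<forall>y. g (j (elem_tensor p sY a y)) = sY (a n) y))"


section \<open>Operator-valued p-approximate Schauder frames\<close>

definition frame_op :: "(nat \<Rightarrow> 'x::banach \<Rightarrow> 'y::banach) \<Rightarrow> (nat \<Rightarrow> 'y \<Rightarrow> 'x) \<Rightarrow> 'x \<Rightarrow> 'x" where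
  "frame_op A \<Psi> x = (\<Sum>n. \<Psi> n (A n x))"

definition analysis_op ::
  "real \<Rightarrow> ('k::real_normed_field \<Rightarrow> 'y::banach \<Rightarrow> 'y) \<Rightarrow>
   ((((nat \<Rightarrow> 'k) \<Rightarrow> 'y \<Rightarrow> 'k) \<Rightarrow> 'k) \<Rightarrow> 'z::banach) \<Rightarrow>
   (nat \<Rightarrow> 'x::banach \<Rightarrow> 'y) \<Rightarrow> 'x \<Rightarrow> 'z" where
  "analysis_op p sY j A x = (\<Sum>n. tensor_L p sY j n (A n x))"

definition synthesis_op ::
  "real \<Rightarrow> ('k::real_normed_field \<Rightarrow> 'y::banach \<Rightarrow> 'y) \<Rightarrow> ('k \<Rightarrow> 'z::banach \<Rightarrow> 'z) \<Rightarrow>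
   ((((nat \<Rightarrow> 'k) \<Rightarrow> 'y \<Rightarrow> 'k) \<Rightarrow> 'k) \<Rightarrow> 'z) \<Rightarrow>
   (nat \<Rightarrow> 'y \<Rightarrow> 'x::banach) \<Rightarrow> 'z \<Rightarrow> 'x" where
  "synthesis_op p sY sZ j \<Psi> z = (\<Sum>n. \<Psi> n (tensor_Gamma p sY sZ j n z))"

text \<open>\<^const>\<open>suminf\<close> is total, so that an operator given by a series is well-defined is expressed by
  the separate \<^const>\<open>summable\<close> conditions.\<close>

definition op_pASF ::
  "real \<Rightarrow> ('k::real_normed_field \<Rightarrow> 'x::banach \<Rightarrow> 'x) \<Rightarrow> ('k \<Rightarrow> 'y::banach \<Rightarrow> 'y) \<Rightarrow>
   ('k \<Rightarrow> 'z::banach \<Rightarrow> 'z) \<Rightarrow> ((((nat \<Rightarrow> 'k) \<Rightarrow> 'y \<Rightarrow> 'k) \<Rightarrow> 'k) \<Rightarrow> 'z) \<Rightarrow>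
   (nat \<Rightarrow> 'x \<Rightarrow> 'y) \<Rightarrow> (nat \<Rightarrow> 'y \<Rightarrow> 'x) \<Rightarrow> bool" where
  "op_pASF p sX sY sZ j A \<Psi> \<longleftrightarrow>
     (\<forall>n. bounded_op sX sY (A n)) \<and> (\<forall>n. bounded_op sY sX (\<Psi> n)) \<and>
     (\<forall>x. summable (\<lambda>n. \<Psi> n (A n x))) \<and> invertible_op sX (frame_op A \<Psi>) \<and>
     (\<forall>x. summable (\<lambda>n. tensor_L p sY j n (A n x))) \<and> bounded_op sX sZ (analysis_op p sY j A) \<and>
     (\<forall>z. summable (\<lambda>n. \<Psi> n (tensor_Gamma p sY sZ j n z))) \<and>
     bounded_op sZ sX (synthesis_op p sY sZ j \<Psi>)"

definition parseval_op_pASF ::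
  "real \<Rightarrow> ('k::real_normed_field \<Rightarrow> 'x::banach \<Rightarrow> 'x) \<Rightarrow> ('k \<Rightarrow> 'y::banach \<Rightarrow> 'y) \<Rightarrow>
   ('k \<Rightarrow> 'z::banach \<Rightarrow> 'z) \<Rightarrow> ((((nat \<Rightarrow> 'k) \<Rightarrow> 'y \<Rightarrow> 'k) \<Rightarrow> 'k) \<Rightarrow> 'z) \<Rightarrow>
   (nat \<Rightarrow> 'x \<Rightarrow> 'y) \<Rightarrow> (nat \<Rightarrow> 'y \<Rightarrow> 'x) \<Rightarrow> bool" where
  "parseval_op_pASF p sX sY sZ j A \<Psi> \<longleftrightarrow> op_pASF p sX sY sZ j A \<Psi> \<and> frame_op A \<Psi> = id"

definition orthogonal_op_pASF ::
  "real \<Rightarrow> ('k::real_normed_field \<Rightarrow> 'y::banach \<Rightarrow> 'y) \<Rightarrow> ('k \<Rightarrow> 'z::banach \<Rightarrow> 'z) \<Rightarrow>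
   ((((nat \<Rightarrow> 'k) \<Rightarrow> 'y \<Rightarrow> 'k) \<Rightarrow> 'k) \<Rightarrow> 'z) \<Rightarrow>
   (nat \<Rightarrow> 'x::banach \<Rightarrow> 'y) \<Rightarrow> (nat \<Rightarrow> 'y \<Rightarrow> 'x) \<Rightarrow>
   (nat \<Rightarrow> 'x \<Rightarrow> 'y) \<Rightarrow> (nat \<Rightarrow> 'y \<Rightarrow> 'x) \<Rightarrow> bool" where
  "orthogonal_op_pASF p sY sZ j A \<Psi> B \<Phi> \<longleftrightarrow>
     synthesis_op p sY sZ j \<Psi> \<circ> analysis_op p sY j B = (\<lambda>x. 0) \<and>
     synthesis_op p sY sZ j \<Phi> \<circ> analysis_op p sY j A = (\<lambda>x. 0)"

end

theory Submission
  imports Defs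
begin

text \<open>
  Multiplying out the frame operator of the combined pair gives
  \<open>E S\<^bsub>A,\<Psi>\<^esub> C + E M D + F N C + F S\<^bsub>B,\<Phi>\<^esub> D\<close>, where \<open>M\<close> and \<open>N\<close> are the mixed series
  \<open>M x = \<Sum>n. \<Psi> n (B n x)\<close> and \<open>N x = \<Sum>n. \<Phi> n (A n x)\<close>. The Parseval property turns the outer
  terms into \<open>E C + F D\<close>, which is the identity, so that everything depends on the mixed series
  being zero. This is what orthogonality says once one knows that \<open>M\<close> is the synthesis operator
  of \<open>\<Psi>\<close> after the analysis operator of \<open>B\<close> (lemma \<open>cross_frame_sums\<close>), and symmetrically for
  \<open>N\<close>. The same identity gives the convergence of the mixed series. The analysis and synthesis
  operators of the combined pair are \<open>\<theta>\<^sub>A C + \<theta>\<^sub>B D\<close> and \<open>E \<theta>\<^sub>\<Psi> + F \<theta>\<^sub>\<Phi>\<close>, hence bounded.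

  The factorisation of \<open>M\<close> amounts to \<open>\<Gamma>\<^sub>n (\<Sum>m. L\<^sub>m (B m x)) = B n x\<close>, which follows from
  \<open>\<Gamma>\<^sub>n L\<^sub>m = \<delta>\<^sub>m\<^sub>n I\<close> and the continuity of \<open>\<Gamma>\<^sub>n\<close>. Since \<open>\<Gamma>\<^sub>n\<close> is introduced by a definite
  description, the real work lies in showing that there is exactly one bounded operator with
  \<open>\<Gamma>\<^sub>n (a \<otimes> y) = a\<^sub>n y\<close>. Uniqueness is the density of the algebraic tensor product. For existence
  (lemma \<open>coord_operator_exists\<close>), let \<open>V\<close> be the extension of \<open>P \<otimes> I\<close>, where \<open>P\<close> is the
  projection of \<open>\<ell>\<^sup>p\<close> onto its \<open>n\<close>-th coordinate axis. By the cross norm property \<open>L\<^sub>n\<close> is an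
  isometry, so its range is closed; since \<open>V\<close> sends elementary tensors into that range, it sends
  the whole completion there, and \<open>L\<^sub>n\<^sup>-\<^sup>1 V\<close> is the required operator.

  The statement about scalars is the case where \<open>C\<close>, \<open>D\<close>, \<open>E\<close>, \<open>F\<close> are multiples of the identity.
\<close>

section \<open>Algebra of bounded operators\<close>

text \<open>Additivity, homogeneity and a norm bound suffice: the real linearity contained in
  \<^const>\<open>bounded_linear\<close> is inherited by restriction of scalars.\<close>

lemma bounded_op_iff:
  assumes "banach_space_over sa" "banach_space_over sb"
  shows "bounded_op sa sb f \<longleftrightarrow>
    (\<forall>x y. f (x + y) = f x + f y) \<and> (\<forall>c x. f (sa c x) = sb c (f x)) \<and>
    (\<exists>M. \<forall>x. norm (f x) \<le> M * norm x)"
proof -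
  interpret a: banach_space_over sa by fact
  interpret b: banach_space_over sb by fact
  have vs: "vector_space sa" "vector_space sb" by unfold_locales
  have scaleR: "f (r *\<^sub>R x) = r *\<^sub>R f x" if "\<forall>c x. f (sa c x) = sb c (f x)" for r x
    using that by (metis a.scale_of_real b.scale_of_real)
  have "bounded_linear f"
    if "\<forall>x y. f (x + y) = f x + f y" "\<forall>c x. f (sa c x) = sb c (f x)"
      "\<forall>x. norm (f x) \<le> M * norm x" for M
    by (rule bounded_linear_intro[where K = M])
      (use that scaleR in \<open>auto simp: mult.commute\<close>)
  moreover have "\<exists>M. \<forall>x. norm (f x) \<le> M * norm x" if "bounded_linear f"
    using bounded_linear.bounded[OF that] by (auto simp: mult.commute)
  ultimately show ?thesis
    unfolding bounded_op_def Vector_Spaces.linear_iff using vs by blast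
qed

lemma bounded_op_add:
  assumes "bounded_op sa sb f" "bounded_op sa sb g"
  shows "bounded_op sa sb (\<lambda>x. f x + g x)"
  using assms unfolding bounded_op_def Vector_Spaces.linear_iff
  by (auto intro: bounded_linear_add
      simp: vector_space.vector_space_assms(1) add_ac)

lemma bounded_op_compose:
  assumes "bounded_op sb sc f" "bounded_op sa sb g"
  shows "bounded_op sa sc (\<lambda>x. f (g x))"
  using assms unfolding bounded_op_def Vector_Spaces.linear_iff
  by (auto intro: bounded_linear_compose)

lemma bounded_op_id: "banach_space_over s \<Longrightarrow> bounded_op s s (\<lambda>x. x)"
  by (subst bounded_op_iff) (auto intro: exI[of _ 1])

lemma bounded_op_scale:
  assumes "banach_space_over s"
  shows "bounded_op s s (s c)"
proof -
  interpret banach_space_over s by fact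
  show ?thesis
    unfolding bounded_op_iff[OF assms assms]
    by (auto simp: scale_right_distrib scale_left_commute norm_scale)
qed

lemma invertible_op_id: "banach_space_over s \<Longrightarrow> invertible_op s id"
  using bounded_op_id[of s] unfolding invertible_op_def id_def[symmetric] by auto

section \<open>Coordinate operators on the tensor product\<close>

lemma lp_basis_in_lp: "lp_basis n \<in> lp p"
  unfolding lp_def mem_Collect_eq
  by (rule summable_finite[of "{n}"]) (auto simp: lp_basis_def)

lemma lp_norm_scale_basis:
  assumes "1 \<le> p"
  shows "lp_norm p (\<lambda>m. c * lp_basis n m) = norm c"
proof -
  have "(\<Sum>m. norm (c * lp_basis n m) powr p)
      = (\<Sum>m\<in>{n}. norm (c * lp_basis n m) powr p)"
    by (rule suminf_finite) (auto simp: lp_basis_def)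
  then show ?thesis
    using assms by (simp add: lp_norm_def lp_basis_def powr_powr)
qed

lemma norm_coord_le_lp_norm:
  assumes "1 \<le> p" "a \<in> lp p"
  shows "norm (a n) \<le> lp_norm p a"
proof -
  have "norm (a n) powr p \<le> (\<Sum>m. norm (a m) powr p)"
    using sum_le_suminf[of "\<lambda>m. norm (a m) powr p" "{n}"] assms(2) by (simp add: lp_def)
  then have "(norm (a n) powr p) powr (1 / p) \<le> lp_norm p a"
    unfolding lp_norm_def using assms(1) by (intro powr_mono2) auto
  then show ?thesis
    using assms(1) by (simp add: powr_powr)
qed

text \<open>The projection onto a coordinate axis is written as a multiple of the basis vector, so that
  its tensor product with the identity is visibly \<open>L\<^sub>n\<close> applied to a multiple of \<open>y\<close>.\<close>

lemma lp_bounded_op_coord_projection: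
  assumes "1 \<le> p"
  shows "lp_bounded_op p (\<lambda>(a :: nat \<Rightarrow> 'k::real_normed_field) m. a n * lp_basis n m)"
proof -
  have "(\<lambda>m. c * lp_basis n m) \<in> lp p" for c :: 'k
    unfolding lp_def mem_Collect_eq
    by (rule summable_finite[of "{n}"]) (auto simp: lp_basis_def)
  then show ?thesis
    unfolding lp_bounded_op_def
    using norm_coord_le_lp_norm[OF assms]
    by (auto simp: lp_norm_scale_basis[OF assms] distrib_right mult.assoc intro!: exI[of _ 1])
qed

lemma elem_tensor_in_alg_tensor:
  assumes "a \<in> lp p"
  shows "elem_tensor p s a y \<in> alg_tensor p s"
  unfolding alg_tensor_def mem_Collect_eq
  by (rule exI[of _ 1], rule exI[of _ "\<lambda>_. a"], rule exI[of _ "\<lambda>_. y"]) (auto simp: assms)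

context lp_tensor
begin

abbreviation tensor :: "(nat \<Rightarrow> 'k) \<Rightarrow> 'y \<Rightarrow> 'z"  (infix "\<odot>" 75)
  where "a \<odot> y \<equiv> j (elem_tensor p sY a y)"

lemma tensor_add_right:
  assumes "a \<in> lp p" shows "a \<odot> (y + z) = a \<odot> y + a \<odot> z"
proof -
  have "elem_tensor p sY a (y + z) = (\<lambda>\<beta>. elem_tensor p sY a y \<beta> + elem_tensor p sY a z \<beta>)"
    using assms by (auto simp: elem_tensor_def bilinear_form_def)
  then show ?thesis
    using assms by (simp add: j_add elem_tensor_in_alg_tensor)
qed

lemma tensor_scale_right:
  assumes "a \<in> lp p" shows "a \<odot> sY c y = sZ c (a \<odot> y)"
proof -
  have "elem_tensor p sY a (sY c y) = (\<lambda>\<beta>. c * elem_tensor p sY a y \<beta>)"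
    using assms by (auto simp: elem_tensor_def bilinear_form_def)
  then show ?thesis
    using assms by (simp add: j_scale elem_tensor_in_alg_tensor)
qed

lemma tensor_scale_left:
  assumes "a \<in> lp p" shows "(\<lambda>m. c * a m) \<odot> y = a \<odot> sY c y"
proof -
  have "elem_tensor p sY (\<lambda>m. c * a m) y = elem_tensor p sY a (sY c y)"
    using assms by (auto simp: elem_tensor_def bilinear_form_def)
  then show ?thesis by simp
qed

text \<open>An induction principle for the image of the algebraic tensor product and, by density, one for
  closed properties of arbitrary elements of the completion. They replace explicit computations
  with finite sums of elementary tensors.\<close>

lemma alg_tensor_induct:
  assumes u: "u \<in> alg_tensor p sY"
    and zero: "P 0"
    and add: "\<And>x a y. P x \<Longrightarrow> a \<in> lp p \<Longrightarrow> P (x + a \<odot> y)"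
  shows "P (j u)"
proof -
  obtain m :: nat and a y where a: "\<forall>i<m. a i \<in> lp p"
    and u_eq: "u = (\<lambda>\<beta>. \<Sum>i<m. elem_tensor p sY (a i) (y i) \<beta>)"
    using u unfolding alg_tensor_def by blast
  define w where "w k = (\<lambda>\<beta>. \<Sum>i<k. elem_tensor p sY (a i) (y i) \<beta>)" for k
  have w_in: "w k \<in> alg_tensor p sY" if "k \<le> m" for k
    using a that unfolding w_def alg_tensor_def by fastforce
  have "k \<le> m \<Longrightarrow> P (j (w k))" for k
  proof (induction k)
    case 0
    \<comment> \<open>\<open>j\<close> is linear only on the algebraic tensor product, so \<open>j 0 = 0\<close> comes from homogeneity.\<close>
    have "w 0 = (\<lambda>\<beta>. 0 * w 0 \<beta>)" by (simp add: w_def)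
    then have "j (w 0) = sZ 0 (j (w 0))"
      using j_scale[OF w_in[of 0], of 0] by simp
    then show ?case using zero by simp
  next
    case (Suc k)
    have "w (Suc k) = (\<lambda>\<beta>. w k \<beta> + elem_tensor p sY (a k) (y k) \<beta>)"
      by (simp add: w_def)
    then have "j (w (Suc k)) = j (w k) + a k \<odot> y k"
      using Suc.prems a w_in[of k] by (simp add: j_add elem_tensor_in_alg_tensor)
    then show ?case
      using Suc add a by simp
  qed
  from this[of m] show ?thesis by (simp add: u_eq w_def)
qed

lemma dense_induct:
  fixes z :: 'z
  assumes "closed {z. P z}" "P 0" "\<And>x a y. P x \<Longrightarrow> a \<in> lp p \<Longrightarrow> P (x + a \<odot> y)"
  shows "P z"
proof -
  have "j ` alg_tensor p sY \<subseteq> {z. P z}"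
    using alg_tensor_induct[of _ P] assms(2,3) by blast
  then have "closure (j ` alg_tensor p sY) \<subseteq> {z. P z}"
    using assms(1) by (rule closure_minimal)
  then show ?thesis by (auto simp: j_dense)
qed

lemma bounded_op_tensor_L: "bounded_op sY sZ (tensor_L p sY j n)"
  and norm_tensor_L: "norm (tensor_L p sY j n y) = norm y"
proof -
  show norm: "norm (tensor_L p sY j n y) = norm y" for y
    using lp_norm_scale_basis[OF p_ge_1, of "1 :: 'k" n]
    by (simp add: tensor_L_def cross_norm lp_basis_in_lp)
  show "bounded_op sY sZ (tensor_L p sY j n)"
    unfolding bounded_op_iff[OF Y.banach_space_over_axioms Z.banach_space_over_axioms]
    using norm by (auto simp: tensor_L_def tensor_add_right tensor_scale_right lp_basis_in_lp
        intro!: exI[of _ 1])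
qed

lemma closed_range_tensor_L: "closed (range (tensor_L p sY j n))"
proof -
  have "complete (range (tensor_L p sY j n))"
    using bounded_op_tensor_L[of n]
    by (intro complete_isometric_image[of 1])
      (auto simp: norm_tensor_L bounded_op_def complete_UNIV)
  then show ?thesis by (rule complete_imp_closed)
qed

text \<open>The operator is obtained by pulling \<open>P \<otimes> I\<close>, with \<open>P\<close> the projection onto the \<open>n\<close>-th
  coordinate axis, back along the isometry \<open>L\<^sub>n\<close>. This is possible because the range of \<open>L\<^sub>n\<close> is
  closed and contains the image of a dense subspace.\<close>

lemma coord_operator_exists:
  "\<exists>g. bounded_op sZ sY g \<and> (\<forall>a\<in>lp p. \<forall>y. g (a \<odot> y) = sY (a n) y)"
proof -
  let ?L = "tensor_L p sY j n"
  note L = bounded_op_tensor_L[of n, unfolded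
      bounded_op_iff[OF Y.banach_space_over_axioms Z.banach_space_over_axioms]]
  obtain V where V: "bounded_op sZ sZ V"
    and V_tensor: "\<And>a y. a \<in> lp p \<Longrightarrow> V (a \<odot> y) = (\<lambda>m. a n * lp_basis n m) \<odot> y"
    using tensor_op[OF lp_bounded_op_coord_projection[OF p_ge_1, of n]
        bounded_op_id[OF Y.banach_space_over_axioms]] by blast
  note V' = V[unfolded bounded_op_iff[OF Z.banach_space_over_axioms Z.banach_space_over_axioms]]
  have V_L: "V (a \<odot> y) = ?L (sY (a n) y)" if "a \<in> lp p" for a y
    using that by (simp add: V_tensor tensor_scale_left lp_basis_in_lp tensor_L_def)
  have V_lin: "bounded_linear V" and L_lin: "bounded_linear ?L"
    using V bounded_op_tensor_L by (auto simp: bounded_op_def)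
  have V_range: "V z \<in> range ?L" for z
  proof (induction z rule: dense_induct)
    case 1
    have "closed (V -` range ?L)"
      using closed_range_tensor_L linear_continuous_on[OF V_lin, of UNIV]
      by (simp add: closed_vimage)
    then show ?case by (simp add: vimage_def)
  next
    case 2
    show ?case
      using linear_simps(3)[OF V_lin] linear_simps(3)[OF L_lin] by (metis rangeI)
  next
    case (3 x a y)
    then obtain y' where "V x = ?L y'" by blast
    then have "V (x + a \<odot> y) = ?L (y' + sY (a n) y)"
      using V' L V_L[OF 3(2)] by simp
    then show ?case by simp
  qed
  have "inj ?L"
  proof (rule injI)
    fix y y' assume "?L y = ?L y'"
    then have "?L (y - y') = 0" by (simp add: linear_simps(2)[OF L_lin])
    then show "y = y'" using norm_tensor_L[of n "y - y'"] by simp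
  qed
  define g where "g z = inv ?L (V z)" for z
  have L_g: "?L (g z) = V z" for z
    unfolding g_def using V_range by (rule f_inv_into_f)
  have "bounded_op sZ sY g"
    unfolding bounded_op_iff[OF Z.banach_space_over_axioms Y.banach_space_over_axioms]
  proof (intro conjI allI)
    show "g (x + y) = g x + g y" for x y
      using V' L by (intro injD[OF \<open>inj ?L\<close>]) (simp add: L_g)
    show "g (sZ c x) = sY c (g x)" for c x
      using V' L by (intro injD[OF \<open>inj ?L\<close>]) (simp add: L_g)
    have "norm (g x) = norm (V x)" for x
      using norm_tensor_L[of n "g x"] by (simp add: L_g)
    then show "\<exists>M. \<forall>x. norm (g x) \<le> M * norm x"
      using V' by simp
  qed
  moreover have "g (a \<odot> y) = sY (a n) y" if "a \<in> lp p" for a y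
    using \<open>inj ?L\<close> that by (simp add: g_def V_L)
  ultimately show ?thesis by blast
qed

lemma bounded_op_eqI_tensor:
  assumes g: "bounded_op sZ sY g" and h: "bounded_op sZ sY h"
    and eq: "\<And>a y. a \<in> lp p \<Longrightarrow> g (a \<odot> y) = h (a \<odot> y)"
  shows "g = h"
proof
  have lin: "bounded_linear g" "bounded_linear h"
    using g h by (auto simp: bounded_op_def)
  fix z show "g z = h z"
  proof (induction z rule: dense_induct)
    case 1
    show ?case
      using lin by (intro closed_Collect_eq linear_continuous_on)
  next
    case 2
    show ?case using lin by (simp add: linear_simps)
  next
    case (3 x a y)
    then show ?case using eq lin by (simp add: linear_simps)
  qed
qed

lemma tensor_Gamma_properties:
  shows bounded_op_tensor_Gamma: "bounded_op sZ sY (tensor_Gamma p sY sZ j n)"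
    and tensor_Gamma_tensor: "a \<in> lp p \<Longrightarrow> tensor_Gamma p sY sZ j n (a \<odot> y) = sY (a n) y"
proof -
  have "\<exists>!g. bounded_op sZ sY g \<and> (\<forall>a\<in>lp p. \<forall>y. g (a \<odot> y) = sY (a n) y)"
    using coord_operator_exists[of n]
  proof (rule ex_ex1I)
    fix g h
    assume "bounded_op sZ sY g \<and> (\<forall>a\<in>lp p. \<forall>y. g (a \<odot> y) = sY (a n) y)"
      and "bounded_op sZ sY h \<and> (\<forall>a\<in>lp p. \<forall>y. h (a \<odot> y) = sY (a n) y)"
    then show "g = h" by (intro bounded_op_eqI_tensor) auto
  qed
  from theI'[OF this]
  show "bounded_op sZ sY (tensor_Gamma p sY sZ j n)"
    and "a \<in> lp p \<Longrightarrow> tensor_Gamma p sY sZ j n (a \<odot> y) = sY (a n) y"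
    unfolding tensor_Gamma_def by auto
qed

lemma tensor_Gamma_tensor_L:
  "tensor_Gamma p sY sZ j n (tensor_L p sY j m y) = (if m = n then y else 0)"
  by (simp add: tensor_L_def tensor_Gamma_tensor lp_basis_in_lp) (simp add: lp_basis_def)

text \<open>The coordinate operators recover the coefficients from an expansion \<open>\<Sum>m. L\<^sub>m (B m x)\<close>, by
  continuity and biorthogonality.\<close>

lemma tensor_Gamma_analysis_op:
  assumes "summable (\<lambda>m. tensor_L p sY j m (B m x))"
  shows "tensor_Gamma p sY sZ j n (analysis_op p sY j B x) = B n x"
proof -
  have "bounded_linear (tensor_Gamma p sY sZ j n)"
    using bounded_op_tensor_Gamma by (simp add: bounded_op_def)
  from bounded_linear.suminf[OF this assms]
  have "tensor_Gamma p sY sZ j n (analysis_op p sY j B x) = (\<Sum>m. if m = n then B m x else 0)"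
    by (simp add: analysis_op_def tensor_Gamma_tensor_L)
  also have "\<dots> = B n x"
    using sums_single[of n "\<lambda>m. B m x"] by (rule sums_unique[symmetric])
  finally show ?thesis .
qed

end

section \<open>Combining orthogonal frames\<close>

lemma synthesis_sums:
  assumes "op_pASF p sX sY sZ j A \<Psi>"
  shows "(\<lambda>n. \<Psi> n (tensor_Gamma p sY sZ j n z)) sums synthesis_op p sY sZ j \<Psi> z"
  using assms unfolding op_pASF_def synthesis_op_def by (simp add: summable_sums)

lemma analysis_sums:
  assumes "op_pASF p sX sY sZ j A \<Psi>"
  shows "(\<lambda>n. tensor_L p sY j n (A n x)) sums analysis_op p sY j A x"
  using assms unfolding op_pASF_def analysis_op_def by (simp add: summable_sums)

text \<open>The two frames may be different: applying the synthesis operator of one to the analysis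
  operator of the other sums the mixed series. This is where orthogonality gets its meaning in terms
  of the frames themselves.\<close>

lemma cross_frame_sums:
  assumes "lp_tensor p sY sZ j" "op_pASF p sX sY sZ j A \<Psi>" "op_pASF p sX sY sZ j B \<Phi>"
  shows "(\<lambda>n. \<Psi> n (B n x)) sums synthesis_op p sY sZ j \<Psi> (analysis_op p sY j B x)"
  using synthesis_sums[OF assms(2), of "analysis_op p sY j B x"]
    lp_tensor.tensor_Gamma_analysis_op[OF assms(1), where B = B and x = x,
      OF sums_summable[OF analysis_sums[OF assms(3)]]]
  by simp

lemma parseval_op_pASF_combine:
  assumes X: "banach_space_over sX" and T: "lp_tensor p sY sZ j"
    and pA: "parseval_op_pASF p sX sY sZ j A \<Psi>"
    and pB: "parseval_op_pASF p sX sY sZ j B \<Phi>"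
    and orth: "orthogonal_op_pASF p sY sZ j A \<Psi> B \<Phi>"
    and C: "bounded_op sX sX C" and D: "bounded_op sX sX D"
    and E: "bounded_op sX sX E" and F: "bounded_op sX sX F"
    and EC_FD: "\<And>x. E (C x) + F (D x) = x"
  shows "parseval_op_pASF p sX sY sZ j
    (\<lambda>n x. A n (C x) + B n (D x)) (\<lambda>n y. E (\<Psi> n y) + F (\<Phi> n y))"
proof -
  interpret lp_tensor p sY sZ j by fact
  let ?G = "\<lambda>n x. A n (C x) + B n (D x)" and ?\<Omega> = "\<lambda>n y. E (\<Psi> n y) + F (\<Phi> n y)"
  have oA: "op_pASF p sX sY sZ j A \<Psi>" and oB: "op_pASF p sX sY sZ j B \<Phi>"
    and SA: "frame_op A \<Psi> = id" and SB: "frame_op B \<Phi> = id"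
    using pA pB by (auto simp: parseval_op_pASF_def)
  have A: "bounded_op sX sY (A n)" and B: "bounded_op sX sY (B n)"
    and \<Psi>: "bounded_op sY sX (\<Psi> n)" and \<Phi>: "bounded_op sY sX (\<Phi> n)" for n
    using oA oB by (auto simp: op_pASF_def)
  have lin: "bounded_linear E" "bounded_linear F"
    "\<And>n. bounded_linear (\<Psi> n)" "\<And>n. bounded_linear (\<Phi> n)"
    "\<And>n. bounded_linear (tensor_L p sY j n)"
    using E F \<Psi> \<Phi> bounded_op_tensor_L by (auto simp: bounded_op_def)
  have diag: "(\<lambda>n. \<Psi> n (A n x)) sums x" "(\<lambda>n. \<Phi> n (B n x)) sums x" for x
    using oA oB summable_sums[of "\<lambda>n. \<Psi> n (A n x)"] summable_sums[of "\<lambda>n. \<Phi> n (B n x)"]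
      fun_cong[OF SA, of x] fun_cong[OF SB, of x]
    by (simp_all add: op_pASF_def frame_op_def)
  have cross: "(\<lambda>n. \<Psi> n (B n x)) sums 0" "(\<lambda>n. \<Phi> n (A n x)) sums 0" for x
    using cross_frame_sums[OF T oA oB, of x] cross_frame_sums[OF T oB oA, of x] orth
    by (simp_all add: orthogonal_op_pASF_def fun_eq_iff)
  \<comment> \<open>The four products are summed separately; the two mixed ones contribute the zeros.\<close>
  have frame: "(\<lambda>n. ?\<Omega> n (?G n x)) sums x" for x
  proof -
    have "(\<lambda>n. E (\<Psi> n (A n (C x)) + \<Psi> n (B n (D x))) + F (\<Phi> n (A n (C x)) + \<Phi> n (B n (D x))))
        sums (E (C x + 0) + F (0 + D x))"
      by (intro sums_add bounded_linear.sums[OF lin(1)] bounded_linear.sums[OF lin(2)] diag cross)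
    then show ?thesis
      by (simp add: EC_FD linear_simps(1)[OF lin(3)] linear_simps(1)[OF lin(4)])
  qed
  have analysis: "(\<lambda>n. tensor_L p sY j n (?G n x)) sums
      (analysis_op p sY j A (C x) + analysis_op p sY j B (D x))" for x
    using sums_add[OF analysis_sums[OF oA] analysis_sums[OF oB]]
    by (simp add: linear_simps(1)[OF lin(5)])
  have synthesis: "(\<lambda>n. ?\<Omega> n (tensor_Gamma p sY sZ j n z)) sums
      (E (synthesis_op p sY sZ j \<Psi> z) + F (synthesis_op p sY sZ j \<Phi> z))" for z
    by (intro sums_add bounded_linear.sums[OF lin(1)] bounded_linear.sums[OF lin(2)]
        synthesis_sums[OF oA] synthesis_sums[OF oB])
  have frame_id: "frame_op ?G ?\<Omega> = id"
    using sums_unique[OF frame] by (simp add: fun_eq_iff frame_op_def)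
  have "bounded_op sX sZ (analysis_op p sY j ?G)"
  proof -
    have "analysis_op p sY j ?G
        = (\<lambda>x. analysis_op p sY j A (C x) + analysis_op p sY j B (D x))"
      using sums_unique[OF analysis] by (simp add: fun_eq_iff analysis_op_def)
    then show ?thesis
      using oA oB C D by (auto simp: op_pASF_def intro: bounded_op_add bounded_op_compose)
  qed
  moreover have "bounded_op sZ sX (synthesis_op p sY sZ j ?\<Omega>)"
  proof -
    have "synthesis_op p sY sZ j ?\<Omega>
        = (\<lambda>z. E (synthesis_op p sY sZ j \<Psi> z) + F (synthesis_op p sY sZ j \<Phi> z))"
      using sums_unique[OF synthesis] by (simp add: fun_eq_iff synthesis_op_def)
    then show ?thesis
      using oA oB E F by (auto simp: op_pASF_def intro: bounded_op_add bounded_op_compose)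
  qed
  moreover have "bounded_op sX sY (?G n)" "bounded_op sY sX (?\<Omega> n)" for n
    by (intro bounded_op_add bounded_op_compose[OF A C] bounded_op_compose[OF B D]
        bounded_op_compose[OF E \<Psi>] bounded_op_compose[OF F \<Phi>])+
  ultimately show ?thesis
    using sums_summable[OF frame] sums_summable[OF analysis] sums_summable[OF synthesis]
      frame_id invertible_op_id[OF X]
    unfolding parseval_op_pASF_def op_pASF_def by simp
qed

theorem proposition3p9:
  fixes p :: real
    and sX :: "'k::real_normed_field \<Rightarrow> 'x::banach \<Rightarrow> 'x"
    and sY :: "'k \<Rightarrow> 'y::banach \<Rightarrow> 'y"
    and sZ :: "'k \<Rightarrow> 'z::banach \<Rightarrow> 'z"
    and j :: "(((nat \<Rightarrow> 'k) \<Rightarrow> 'y \<Rightarrow> 'k) \<Rightarrow> 'k) \<Rightarrow> 'z"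
    and A B :: "nat \<Rightarrow> 'x \<Rightarrow> 'y"
    and \<Psi> \<Phi> :: "nat \<Rightarrow> 'y \<Rightarrow> 'x"
  assumes "banach_space_over sX"
    and "lp_tensor p sY sZ j"
    and "parseval_op_pASF p sX sY sZ j A \<Psi>"
    and "parseval_op_pASF p sX sY sZ j B \<Phi>"
    and "orthogonal_op_pASF p sY sZ j A \<Psi> B \<Phi>"
  shows "(\<forall>C D E F. bounded_op sX sX C \<and> bounded_op sX sX D \<and>
            bounded_op sX sX E \<and> bounded_op sX sX F \<and>
            (\<forall>x. E (C x) + F (D x) = x) \<longrightarrow>
            parseval_op_pASF p sX sY sZ j
              (\<lambda>n x. A n (C x) + B n (D x)) (\<lambda>n y. E (\<Psi> n y) + F (\<Phi> n y))) \<and>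
         (\<forall>c d e f. c * e + d * f = 1 \<longrightarrow>
            parseval_op_pASF p sX sY sZ j
              (\<lambda>n x. sY c (A n x) + sY d (B n x)) (\<lambda>n y. sX e (\<Psi> n y) + sX f (\<Phi> n y)))"
proof (intro conjI allI impI)
  fix C D E F
  assume "bounded_op sX sX C \<and> bounded_op sX sX D \<and>
    bounded_op sX sX E \<and> bounded_op sX sX F \<and> (\<forall>x. E (C x) + F (D x) = x)"
  then show "parseval_op_pASF p sX sY sZ j
      (\<lambda>n x. A n (C x) + B n (D x)) (\<lambda>n y. E (\<Psi> n y) + F (\<Phi> n y))"
    by (intro parseval_op_pASF_combine[OF assms]) auto
next
  interpret X: banach_space_over sX by fact
  fix c d e f :: 'k
  assume cd: "c * e + d * f = 1"
  have "sX e (sX c x) + sX f (sX d x) = x" for x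
    using cd by (simp add: X.scale_left_distrib[symmetric] mult.commute)
  then have "parseval_op_pASF p sX sY sZ j
      (\<lambda>n x. A n (sX c x) + B n (sX d x)) (\<lambda>n y. sX e (\<Psi> n y) + sX f (\<Phi> n y))"
    by (intro parseval_op_pASF_combine[OF assms] bounded_op_scale[OF assms(1)])
  moreover have "A n (sX r x) = sY r (A n x)" "B n (sX r x) = sY r (B n x)" for n r x
    using assms(3,4)
    by (simp_all add: parseval_op_pASF_def op_pASF_def bounded_op_def Vector_Spaces.linear_iff)
  ultimately show "parseval_op_pASF p sX sY sZ j
      (\<lambda>n x. sY c (A n x) + sY d (B n x)) (\<lambda>n y. sX e (\<Psi> n y) + sX f (\<Phi> n y))"
    by simp
qed

end
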